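(* For every $n \ge 1$ and every vector $s=(s_1,\dotsc,s_n) \in \mathbb{Z}_{\ge 0}^n$, the bit adder function $\mathrm{BA}_n^{s}\colon\{0,1\}^n\to\{0,1\}^m$ can be computed by a Boolean circuit over the full binary basis of size at most $4.5n-2m$.
   Context: A Boolean circuit over the full binary basis is a directed acyclic graph whose source nodes (input gates) are labeled by the input variables $x_1,\dotsc,x_n$ and the constants $0,1$, and whose other nodes (internal gates) have in-degree $2$ and are labeled by arbitrary binary Boolean operations; some gates are designated as outputs. The size of a circuit is its number of internal gates, and $\operatorname{size}(f)$ is the minimum size of a circuit computing $f$. For $s \in \mathbb{Z}_{\ge 0}^n$, the bit adder $\mathrm{BA}_n^s$ maps $(x_1,\dotsc,x_n)\in\{0,1\}^n$ to $(y_0,\dotsc,y_{m-1})\in\{0,1\}^m$, where $0\le t_0<t_1<\dotsb<t_{m-1}$ are exactly those bit positions of the binary representation of $\sum_{i=1}^n 2^{s_i}x_i$ that are not identically zero as functions of the input, and $y_j$ is the bit at position $t_j$, so that $\sum_{i=1}^n 2^{s_i}x_i=\sum_{j=0}^{m-1}2^{t_j}y_j$. (Here $m\le n$ is determined by $s$.) *)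

theory Defs
  imports Complex_Main
begin

section \<open>Boolean circuits over the full binary basis\<close>

text \<open>\<open>Var i\<close> is the input gate labelled by the \<open>i\<close>-th input variable (counted from 0),
  \<open>Const b\<close> the input gate labelled by the constant \<open>b\<close>, and \<open>Gate g\<close> an internal gate.\<close>

datatype node = Var nat | Const bool | Gate nat

record circuit =
  gates   :: "nat set"
  oper    :: "nat \<Rightarrow> bool \<Rightarrow> bool \<Rightarrow> bool"
  left    :: "nat \<Rightarrow> node"
  right   :: "nat \<Rightarrow> node"
  outputs :: "node list"

definition nodes :: "nat \<Rightarrow> circuit \<Rightarrow> node set" where
  "nodes n C = Var ` {..<n} \<union> range Const \<union> Gate ` gates C"

definition wires :: "circuit \<Rightarrow> (node \<times> node) set" where
  "wires C = {(u, Gate g) | u g. g \<in> gates C \<and> (u = left C g \<or> u = right C g)}"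

text \<open>The two wires entering an internal gate may come from the same node. The operation
  is applied to them in the order left, right. Any node, including an input gate, may be an
  output.\<close>

definition is_circuit :: "nat \<Rightarrow> circuit \<Rightarrow> bool" where
  "is_circuit n C \<longleftrightarrow>
     finite (gates C) \<and>
     (\<forall>g \<in> gates C. left C g \<in> nodes n C \<and> right C g \<in> nodes n C) \<and>
     acyclic (wires C) \<and>
     set (outputs C) \<subseteq> nodes n C"

definition circuit_size :: "circuit \<Rightarrow> nat" where
  "circuit_size C = card (gates C)"

inductive evaluates :: "circuit \<Rightarrow> bool list \<Rightarrow> node \<Rightarrow> bool \<Rightarrow> bool"
  for C :: circuit and x :: "bool list" where
  Var: "i < length x \<Longrightarrow> evaluates C x (Var i) (x ! i)"
| Const: "evaluates C x (Const b) b"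
| Gate: "\<lbrakk>g \<in> gates C; evaluates C x (left C g) a; evaluates C x (right C g) b\<rbrakk>
         \<Longrightarrow> evaluates C x (Gate g) (oper C g a b)"

definition computes :: "nat \<Rightarrow> circuit \<Rightarrow> (bool list \<Rightarrow> bool list) \<Rightarrow> bool" where
  "computes n C f \<longleftrightarrow>
     is_circuit n C \<and>
     (\<forall>x. length x = n \<longrightarrow> list_all2 (evaluates C x) (outputs C) (f x))"

text \<open>On a circuit, every node has exactly one value on every input, so \<open>computes\<close>
  says that the outputs of \<open>C\<close> are the values of \<open>f\<close>.\<close>

lemma evaluates_unique:
  "evaluates C x u a \<Longrightarrow> evaluates C x u b \<Longrightarrow> a = b"
proof (induction arbitrary: b rule: evaluates.induct)
  case (Gate g a b c)
  from Gate.prems show ?case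
    by cases (use Gate.IH in blast)
qed (auto elim: evaluates.cases)

lemma evaluates_total:
  assumes C: "is_circuit n C" and x: "length x = n" and u: "u \<in> nodes n C"
  shows "\<exists>!b. evaluates C x u b"
proof -
  have "wires C \<subseteq> (\<lambda>g. (left C g, Gate g)) ` gates C \<union> (\<lambda>g. (right C g, Gate g)) ` gates C"
    by (auto simp: wires_def)
  then have "finite (wires C)"
    using C by (meson finite_Un finite_imageI finite_subset is_circuit_def)
  then have wf: "wf (wires C)"
    using C finite_acyclic_wf is_circuit_def by blast
  have "\<exists>b. evaluates C x u b"
    using wf u
  proof (induction u rule: wf_induct_rule)
    case (less u)
    then consider i where "u = Var i" "i < n" | b where "u = Const b"
      | g where "u = Gate g" "g \<in> gates C"
      by (auto simp: nodes_def)
    then show ?case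
    proof cases
      case 3
      then have "(left C g, u) \<in> wires C" "(right C g, u) \<in> wires C"
        by (auto simp: wires_def)
      then obtain a b where "evaluates C x (left C g) a" "evaluates C x (right C g) b"
        using less.IH C 3 by (meson is_circuit_def)
      then show ?thesis
        using 3 evaluates.Gate by blast
    qed (use x in \<open>auto intro: evaluates.intros\<close>)
  qed
  then show ?thesis
    using evaluates_unique by blast
qed


section \<open>The bit adder\<close>

text \<open>The vector \<open>s\<close> and the input \<open>x\<close> are lists of the same length \<open>n\<close>.\<close>

definition weighted_sum :: "nat list \<Rightarrow> bool list \<Rightarrow> nat" where
  "weighted_sum s x = (\<Sum>i<length s. 2 ^ (s ! i) * of_bool (x ! i))"

definition BA_positions :: "nat list \<Rightarrow> nat set" where
  "BA_positions s = {t. \<exists>x. length x = length s \<and> bit (weighted_sum s x) t}"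

definition BA_outputs :: "nat list \<Rightarrow> nat" where
  "BA_outputs s = card (BA_positions s)"

definition BA :: "nat list \<Rightarrow> bool list \<Rightarrow> bool list" where
  "BA s x = map (bit (weighted_sum s x)) (sorted_list_of_set (BA_positions s))"

lemma finite_BA_positions: "finite (BA_positions s)"
proof (rule finite_subset)
  let ?N = "\<Sum>i<length s. 2 ^ (s ! i) :: nat"
  show "BA_positions s \<subseteq> {..?N}"
  proof
    fix t assume "t \<in> BA_positions s"
    then obtain x where b: "bit (weighted_sum s x) t"
      by (auto simp: BA_positions_def)
    then have "2 ^ t \<le> weighted_sum s x"
      by (metis bit_iff_odd div_less even_zero not_le)
    also have "\<dots> \<le> ?N"
      unfolding weighted_sum_def by (rule sum_mono) auto
    finally show "t \<in> {..?N}"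
      using less_exp[of t] by (metis atMost_iff less_imp_le order_trans)
  qed
qed simp

lemma length_BA: "length (BA s x) = BA_outputs s"
  by (simp add: BA_def BA_outputs_def)

lemma weighted_sum_eq_BA:
  assumes "length x = length s"
  shows "weighted_sum s x =
    (\<Sum>j<BA_outputs s. 2 ^ (sorted_list_of_set (BA_positions s) ! j) * of_bool (BA s x ! j))"
proof -
  let ?v = "weighted_sum s x" and ?T = "sorted_list_of_set (BA_positions s)"
  define N where "N = Suc (?v + Max (insert 0 (BA_positions s)))"
  have sub: "BA_positions s \<subseteq> {..<N}"
    using finite_BA_positions[of s] by (auto simp: N_def less_Suc_eq_le intro!: trans_le_add2 Max_ge)
  have "?v < 2 ^ N"
    using less_exp[of N] by (simp add: N_def)
  then have "?v = take_bit N ?v"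
    by (simp add: take_bit_nat_eq_self)
  also have "\<dots> = (\<Sum>t<N. 2 ^ t * of_bool (bit ?v t))"
    by (simp add: take_bit_sum push_bit_eq_mult lessThan_atLeast0 mult.commute)
  also have "\<dots> = (\<Sum>t\<in>BA_positions s. 2 ^ t * of_bool (bit ?v t))"
    using sub assms by (intro sum.mono_neutral_right) (auto simp: BA_positions_def)
  also have "\<dots> = (\<Sum>t\<leftarrow>?T. 2 ^ t * of_bool (bit ?v t))"
    by (simp add: sum_list_distinct_conv_sum_set finite_BA_positions)
  also have "\<dots> = (\<Sum>j<BA_outputs s. 2 ^ (?T ! j) * of_bool (BA s x ! j))"
    by (simp add: sum_list_sum_nth BA_outputs_def BA_def lessThan_atLeast0)
  finally show ?thesis .
qed

end

theory Submission imports Defs begin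

text \<open>Besides single bits, pairs of bits \<open>x, y\<close> are carried along in the encoded form
  \<open>(x, x \<oplus> y)\<close>. Two full adders chained at the same bit position then need only 8 gates in
  place of 10: they turn a bit and two encoded pairs into a sum bit and one encoded pair of
  carries. Assign the potential \<open>9/2\<close> to a single bit and \<open>8\<close> to an encoded pair. Encoding
  two bits (1 gate) and the double full adder (8 gates) are paid for exactly by the loss of
  potential. The bit positions are treated from the lowest one upwards; when a position
  is finished, its last bit becomes an output that retains the potential \<open>2\<close>, and
  the \<open>5/2\<close> set free cover the half adder and the full adder that may be needed at
  that position. A position at which no bit arrives is identically zero, so at least \<open>m\<close>
  outputs retain potential. In the formal statements all potentials are doubled.\<close>

section \<open>Straight-line programs\<close>

text \<open>\<open>F\<close> holds all functions available after \<open>k\<close> gates, so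
  intermediate results can be reused freely without naming nodes or wires.\<close>

inductive straight :: "nat \<Rightarrow> nat \<Rightarrow> (bool list \<Rightarrow> bool) set \<Rightarrow> bool" for n where
  inputs: "straight n 0 ((\<lambda>i x. x ! i) ` {..<n} \<union> range (\<lambda>b x. b))"
| gate: "\<lbrakk>straight n k F; f \<in> F; g \<in> F\<rbrakk> \<Longrightarrow>
    straight n (Suc k) (insert (\<lambda>x. op (f x) (g x)) F)"

text \<open>Inputs rank below all gates, and gates rank by their number.\<close>

fun rank :: "node \<Rightarrow> nat" where
  "rank (Gate g) = Suc g"
| "rank _ = 0"

text \<open>Gates are numbered in order of creation. The clause on \<open>wires\<close> strengthens
  acyclicity to a form that survives appending gate \<open>k\<close>, whose rank
  \<open>Suc k\<close> exceeds that of every earlier node.\<close>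

lemma straight_circuit:
  assumes "straight n k F"
  shows "\<exists>C. is_circuit n C \<and> gates C = {..<k} \<and> wires C \<subseteq> measure rank \<and>
    (\<forall>f\<in>F. \<exists>u\<in>nodes n C. \<forall>x. length x = n \<longrightarrow> evaluates C x u (f x))"
  using assms
proof induction
  case inputs
  let ?C = "\<lparr>gates = {}, oper = (\<lambda>_ a b. a), left = (\<lambda>_. Const False),
    right = (\<lambda>_. Const False), outputs = []\<rparr>"
  have "wires ?C = {}"
    by (auto simp: wires_def)
  moreover have "\<exists>u\<in>nodes n ?C. \<forall>x. length x = n \<longrightarrow> evaluates ?C x u (f x)"
    if "f \<in> (\<lambda>i x. x ! i) ` {..<n} \<union> range (\<lambda>b x. b)" for f
    using that
  proof
    assume "f \<in> (\<lambda>i x. x ! i) ` {..<n}"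
    then obtain i where i: "i < n" "f = (\<lambda>x. x ! i)"
      by auto
    show ?thesis
      by (rule bexI[of _ "Var i"]) (use i in \<open>auto simp: nodes_def intro: evaluates.Var\<close>)
  next
    assume "f \<in> range (\<lambda>b x. b)"
    then obtain b where b: "f = (\<lambda>x. b)"
      by auto
    show ?thesis
      by (rule bexI[of _ "Const b"]) (use b in \<open>auto simp: nodes_def intro: evaluates.Const\<close>)
  qed
  ultimately show ?case
    by (intro exI[of _ ?C]) (simp add: is_circuit_def acyclic_def)
next
  case (gate k F f g op)
  then obtain C where C: "is_circuit n C" "gates C = {..<k}" "wires C \<subseteq> measure rank"
    and ev: "\<forall>f\<in>F. \<exists>u\<in>nodes n C. \<forall>x. length x = n \<longrightarrow> evaluates C x u (f x)"
    by blast
  obtain u where u: "u \<in> nodes n C" "\<And>x. length x = n \<Longrightarrow> evaluates C x u (f x)"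
    using ev gate.hyps by blast
  obtain v where v: "v \<in> nodes n C" "\<And>x. length x = n \<Longrightarrow> evaluates C x v (g x)"
    using ev gate.hyps by blast
  define D where "D = \<lparr>gates = {..<Suc k}, oper = (oper C)(k := op),
    left = (left C)(k := u), right = (right C)(k := v), outputs = []\<rparr>"
  have nodes: "nodes n C \<subseteq> nodes n D" "Gate k \<in> nodes n D"
    by (auto simp: nodes_def D_def C(2))
  have "rank w \<le> k" if "w \<in> nodes n C" for w
    using that unfolding nodes_def C(2) by (elim UnE imageE) simp_all
  moreover have "wires D = wires C \<union> {(u, Gate k), (v, Gate k)}"
    by (auto simp: wires_def D_def C(2) less_Suc_eq)
  ultimately have wires: "wires D \<subseteq> measure rank"
    using C(3) u(1) v(1) by (auto simp: less_Suc_eq_le)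
  have "acyclic (wires D)"
    using wires by (rule acyclic_subset[OF wf_acyclic[OF wf_measure]])
  moreover have "left D h \<in> nodes n D \<and> right D h \<in> nodes n D" if "h \<in> gates D" for h
  proof -
    have "left D h \<in> nodes n C \<and> right D h \<in> nodes n C"
      using that C u(1) v(1) by (auto simp: D_def is_circuit_def)
    then show ?thesis
      using nodes by blast
  qed
  ultimately have "is_circuit n D"
    by (simp add: is_circuit_def) (simp add: D_def)
  \<comment> \<open>\<open>k\<close> is not a gate of \<open>C\<close>, so the old gates keep their
    operations and wires in \<open>D\<close>.\<close>
  have mono: "evaluates D x w b" if "evaluates C x w b" for x w b
    using that
  proof induction
    case (Gate h a b)
    then show ?case
      using evaluates.Gate[of h D x a b] C(2) by (simp add: D_def)
  qed (auto intro: evaluates.intros)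
  moreover have "evaluates D x (Gate k) (op (f x) (g x))" if "length x = n" for x
    using evaluates.Gate[of k D x "f x" "g x"] mono[OF u(2)[OF that]] mono[OF v(2)[OF that]]
    by (simp add: D_def)
  ultimately have "\<exists>w\<in>nodes n D. \<forall>x. length x = n \<longrightarrow> evaluates D x w (h x)"
    if "h \<in> insert (\<lambda>x. op (f x) (g x)) F" for h
    using that ev nodes by blast
  moreover have "gates D = {..<Suc k}"
    by (simp add: D_def)
  ultimately show ?case
    using \<open>is_circuit n D\<close> wires by blast
qed

lemma straight_computes:
  assumes "straight n k F" "set fs \<subseteq> F"
  shows "\<exists>C. computes n C (\<lambda>x. map (\<lambda>f. f x) fs) \<and> circuit_size C = k"
proof -
  obtain C where C: "is_circuit n C" "gates C = {..<k}"
    and ev: "\<forall>f\<in>F. \<exists>u\<in>nodes n C. \<forall>x. length x = n \<longrightarrow> evaluates C x u (f x)"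
    using straight_circuit[OF assms(1)] by blast
  from ev obtain u where u: "\<forall>f\<in>F. u f \<in> nodes n C \<and>
      (\<forall>x. length x = n \<longrightarrow> evaluates C x (u f) (f x))"
    by metis
  define D where "D = C\<lparr>outputs := map u fs\<rparr>"
  have "evaluates D x w b" if "evaluates C x w b" for x w b
    using that
  proof induction
    case (Gate h a b)
    then show ?case
      using evaluates.Gate[of h D x a b] by (simp add: D_def)
  qed (auto intro: evaluates.intros)
  moreover have "is_circuit n D"
    using C(1) u assms(2) by (auto simp: is_circuit_def D_def nodes_def wires_def)
  ultimately have "computes n D (\<lambda>x. map (\<lambda>f. f x) fs)"
    using u assms(2) by (auto simp: computes_def D_def list_all2_map1 list_all2_map2 list_all2_same)
  then show ?thesis
    using C(2) by (intro exI[of _ D]) (simp add: circuit_size_def D_def)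
qed

section \<open>One bit position\<close>

text \<open>A pair \<open>(a, b)\<close> in \<open>P\<close> encodes the two bits \<open>a\<close> and \<open>a \<oplus> b\<close>.\<close>

definition tally ::
  "(bool list \<Rightarrow> bool) list \<Rightarrow> ((bool list \<Rightarrow> bool) \<times> (bool list \<Rightarrow> bool)) list \<Rightarrow> bool list \<Rightarrow> nat" where
  "tally A P x = (\<Sum>a\<leftarrow>A. of_bool (a x)) + (\<Sum>(a, b)\<leftarrow>P. of_bool (a x) + of_bool (a x \<noteq> b x))"

lemma tally_simps [simp]:
  "tally [] [] x = 0"
  "tally (a # A) P x = of_bool (a x) + tally A P x"
  "tally A ((a, b) # P) x = of_bool (a x) + of_bool (a x \<noteq> b x) + tally A P x"
  by (simp_all add: tally_def)

lemma tally_append: "tally (A @ B) P x = tally A P x + tally B [] x"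
  by (simp add: tally_def)

text \<open>One XOR gate (weight 2) turns two bits (weight 18) into a pair (weight 16), so the bound
  is preserved exactly. The emptiness clause ensures that a position with some bit keeps
  one.\<close>

lemma pair_up:
  assumes "straight n k F" "set A \<subseteq> F" "set P \<subseteq> F \<times> F"
  shows "\<exists>k' F' A' P'. straight n k' F' \<and> F \<subseteq> F' \<and> set A' \<subseteq> F' \<and> set P' \<subseteq> F' \<times> F' \<and>
    length A' \<le> 1 \<and> (A' = [] \<and> P' = [] \<longrightarrow> A = [] \<and> P = []) \<and> tally A' P' = tally A P \<and>
    2 * k' + 9 * length A' + 16 * length P' \<le> 2 * k + 9 * length A + 16 * length P"
  using assms
proof (induction A arbitrary: k F P rule: induct_list012)
  case (3 a b A)
  let ?c = "\<lambda>x. a x \<noteq> b x"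
  have "straight n (Suc k) (insert ?c F)"
    using straight.gate[OF "3.prems"(1), of a b "(\<noteq>)"] "3.prems"(2) by simp
  moreover have "set A \<subseteq> insert ?c F" "set ((a, ?c) # P) \<subseteq> insert ?c F \<times> insert ?c F"
    using "3.prems"(2,3) by auto
  ultimately obtain k' F' A' P' where *:
    "straight n k' F'" "insert ?c F \<subseteq> F'" "set A' \<subseteq> F'" "set P' \<subseteq> F' \<times> F'" "length A' \<le> 1"
    "A' = [] \<and> P' = [] \<longrightarrow> A = [] \<and> (a, ?c) # P = []" "tally A' P' = tally A ((a, ?c) # P)"
    "2 * k' + 9 * length A' + 16 * length P' \<le>
       2 * Suc k + 9 * length A + 16 * length ((a, ?c) # P)"
    using "3.IH"(1)[of "Suc k" "insert ?c F" "(a, ?c) # P"] by blast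
  have "tally A ((a, ?c) # P) = tally (a # b # A) P"
    by auto
  then show ?case
    using * by (intro exI[of _ k'] exI[of _ F'] exI[of _ A'] exI[of _ P']) auto
next
  case 1
  then show ?case
    by (intro exI[of _ k] exI[of _ F] exI[of _ "[]"] exI[of _ P]) auto
next
  case (2 a)
  then show ?case
    by (intro exI[of _ k] exI[of _ F] exI[of _ "[a]"] exI[of _ P]) auto
qed

text \<open>The sum z \<oplus> a \<oplus> (a \<oplus> b) is z \<oplus> b, a single gate. If
  \<open>b\<close> is false, both encoded bits are \<open>a\<close> and the carry is a = r \<oplus>
  (a \<oplus> z); if \<open>b\<close> is true, the carry is z = r \<oplus> 1. The gate
  \<open>h\<close> merges the two cases.\<close>

lemma full_adder:
  assumes "straight n k F" "{z, a, b} \<subseteq> F"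
  shows "\<exists>F' r c. straight n (k + 4) F' \<and> F \<subseteq> F' \<and> {r, c} \<subseteq> F' \<and>
    (\<forall>x. of_bool (z x) + of_bool (a x) + of_bool (a x \<noteq> b x) =
         (of_bool (r x) + 2 * of_bool (c x) :: nat))"
proof -
  define r where "r = (\<lambda>x. z x \<noteq> b x)"
  define g where "g = (\<lambda>x. a x \<noteq> z x)"
  define h where "h = (\<lambda>x. b x \<or> g x)"
  define c where "c = (\<lambda>x. r x \<noteq> h x)"
  have "straight n (Suc k) (insert r F)"
    unfolding r_def using straight.gate[OF assms(1), of z b "(\<noteq>)"] assms(2) by simp
  then have "straight n (Suc (Suc k)) (insert g (insert r F))"
    unfolding g_def using straight.gate[where f = a and g = z and op = "(\<noteq>)"] assms(2) by simp
  then have "straight n (Suc (Suc (Suc k))) (insert h (insert g (insert r F)))"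
    unfolding h_def using straight.gate[where f = b and g = g and op = "(\<or>)"] assms(2) by simp
  then have "straight n (Suc (Suc (Suc (Suc k)))) (insert c (insert h (insert g (insert r F))))"
    unfolding c_def using straight.gate[where f = r and g = h and op = "(\<noteq>)"] by simp
  then have "straight n (k + 4) (insert c (insert h (insert g (insert r F))))"
    by (simp add: numeral_eq_Suc)
  moreover have "of_bool (z x) + of_bool (a x) + of_bool (a x \<noteq> b x) =
      (of_bool (r x) + 2 * of_bool (c x) :: nat)" for x
    by (cases "z x"; cases "a x"; cases "b x") (simp_all add: r_def g_def h_def c_def)
  ultimately show ?thesis
    by blast
qed

text \<open>The carry of the first full adder is \<open>c = s \<oplus> h\<close> and that of the second one is
  \<open>s \<oplus> u\<close>, with the sum bit \<open>s\<close> of the first. Hence the second component of the encoded pair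
  of carries is \<open>h \<oplus> u\<close>, and the second carry itself is never computed.\<close>

lemma double_full_adder:
  assumes "straight n k F" "{z, a, b, a', b'} \<subseteq> F"
  shows "\<exists>F' r c d. straight n (k + 8) F' \<and> F \<subseteq> F' \<and> {r, c, d} \<subseteq> F' \<and>
    (\<forall>x. of_bool (z x) + of_bool (a x) + of_bool (a x \<noteq> b x) + of_bool (a' x) + of_bool (a' x \<noteq> b' x) =
         (of_bool (r x) + 2 * (of_bool (c x) + of_bool (c x \<noteq> d x)) :: nat))"
proof -
  define s where "s = (\<lambda>x. z x \<noteq> b x)"
  define g where "g = (\<lambda>x. a x \<noteq> z x)"
  define h where "h = (\<lambda>x. b x \<or> g x)"
  define c where "c = (\<lambda>x. s x \<noteq> h x)"
  define r where "r = (\<lambda>x. s x \<noteq> b' x)"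
  define t where "t = (\<lambda>x. a' x \<noteq> s x)"
  \<comment> \<open>The second carry is \<open>a'\<close> = s \<oplus> t if \<open>b'\<close> is
    false, and \<open>s\<close> otherwise. Expressing it relative to the incoming bit
    \<open>s\<close>, not the outgoing \<open>r\<close>, lets \<open>s\<close> cancel against the
    first carry.\<close>
  define u where "u = (\<lambda>x. t x \<and> \<not> b' x)"
  define d where "d = (\<lambda>x. h x \<noteq> u x)"
  let ?F = "insert c (insert h (insert g (insert s F)))"
  have "straight n (Suc k) (insert s F)"
    unfolding s_def using straight.gate[OF assms(1), of z b "(\<noteq>)"] assms(2) by simp
  then have "straight n (Suc (Suc k)) (insert g (insert s F))"
    unfolding g_def using straight.gate[where f = a and g = z and op = "(\<noteq>)"] assms(2) by simp
  then have "straight n (Suc (Suc (Suc k))) (insert h (insert g (insert s F)))"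
    unfolding h_def using straight.gate[where f = b and g = g and op = "(\<or>)"] assms(2) by simp
  then have "straight n (Suc (Suc (Suc (Suc k)))) ?F"
    unfolding c_def using straight.gate[where f = s and g = h and op = "(\<noteq>)"] by simp
  then have "straight n (Suc (Suc (Suc (Suc (Suc k))))) (insert r ?F)"
    unfolding r_def using straight.gate[where f = s and g = b' and op = "(\<noteq>)"] assms(2) by simp
  then have "straight n (Suc (Suc (Suc (Suc (Suc (Suc k)))))) (insert t (insert r ?F))"
    unfolding t_def using straight.gate[where f = a' and g = s and op = "(\<noteq>)"] assms(2) by simp
  then have "straight n (Suc (Suc (Suc (Suc (Suc (Suc (Suc k))))))) (insert u (insert t (insert r ?F)))"
    unfolding u_def using straight.gate[where f = t and g = b' and op = "\<lambda>p q. p \<and> \<not> q"] assms(2)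
    by simp
  then have "straight n (Suc (Suc (Suc (Suc (Suc (Suc (Suc (Suc k))))))))
      (insert d (insert u (insert t (insert r ?F))))"
    unfolding d_def using straight.gate[where f = h and g = u and op = "(\<noteq>)"] by simp
  then have "straight n (k + 8) (insert d (insert u (insert t (insert r ?F))))"
    by (simp add: numeral_eq_Suc)
  moreover have "of_bool (z x) + of_bool (a x) + of_bool (a x \<noteq> b x) + of_bool (a' x)
      + of_bool (a' x \<noteq> b' x) =
      (of_bool (r x) + 2 * (of_bool (c x) + of_bool (c x \<noteq> d x)) :: nat)" for x
    by (cases "z x"; cases "a x"; cases "b x"; cases "a' x"; cases "b' x")
      (simp_all add: s_def g_def h_def c_def r_def t_def u_def d_def)
  ultimately show ?thesis
    by blast
qed

text \<open>Two pairs (weight 32) pay for 8 gates and one pair of carries (16 + 16). A leftover pair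
  (16) falls short of 4 gates and a single carry (8 + 9) by 1, whence the \<open>+ 1\<close>. The
  running bit \<open>z\<close> has no weight here.\<close>

lemma add_pairs:
  assumes "straight n k F" "z \<in> F" "set P \<subseteq> F \<times> F"
  shows "\<exists>k' F' r A' P'. straight n k' F' \<and> F \<subseteq> F' \<and> r \<in> F' \<and> set A' \<subseteq> F' \<and> set P' \<subseteq> F' \<times> F' \<and>
    (\<forall>x. of_bool (z x) + tally [] P x = of_bool (r x) + 2 * tally A' P' x) \<and>
    2 * k' + 9 * length A' + 16 * length P' \<le> 2 * k + 16 * length P + 1"
  using assms
proof (induction P arbitrary: k F z rule: induct_list012)
  case 1
  then show ?case
    by (intro exI[of _ k] exI[of _ F] exI[of _ z] exI[of _ "[]"]) auto
next
  case (2 p)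
  obtain a b where p: "p = (a, b)"
    by fastforce
  then obtain F' r c where "straight n (k + 4) F'" "F \<subseteq> F'" "{r, c} \<subseteq> F'"
    "\<forall>x. of_bool (z x) + of_bool (a x) + of_bool (a x \<noteq> b x) =
      (of_bool (r x) + 2 * of_bool (c x) :: nat)"
    using full_adder[OF "2.prems"(1), of z a b] "2.prems" by auto
  then show ?case
    using p
    by (intro exI[of _ "k + 4"] exI[of _ F'] exI[of _ r] exI[of _ "[c]"] exI[of _ "[]"])
      (auto simp: add.assoc)
next
  case (3 p q P)
  obtain a b a' b' where p: "p = (a, b)" "q = (a', b')"
    by fastforce
  then obtain F1 s c d where 1: "straight n (k + 8) F1" "F \<subseteq> F1" "{s, c, d} \<subseteq> F1"
    "\<forall>x. of_bool (z x) + of_bool (a x) + of_bool (a x \<noteq> b x) + of_bool (a' x) + of_bool (a' x \<noteq> b' x) =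
      (of_bool (s x) + 2 * (of_bool (c x) + of_bool (c x \<noteq> d x)) :: nat)"
    using double_full_adder[OF "3.prems"(1), of z a b a' b'] "3.prems" by auto
  have "set P \<subseteq> F1 \<times> F1"
    using "3.prems"(3) 1(2) by auto
  then obtain k' F' r A' P' where 2: "straight n k' F'" "F1 \<subseteq> F'" "r \<in> F'" "set A' \<subseteq> F'"
    "set P' \<subseteq> F' \<times> F'"
    "\<forall>x. of_bool (s x) + tally [] P x = of_bool (r x) + 2 * tally A' P' x"
    "2 * k' + 9 * length A' + 16 * length P' \<le> 2 * (k + 8) + 16 * length P + 1"
    using "3.IH"(1)[OF 1(1), of s] 1(3) by auto
  have "of_bool (z x) + tally [] (p # q # P) x = of_bool (r x) + 2 * tally A' ((c, d) # P') x" for x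
    using 1(4)[rule_format, of x] 2(6)[rule_format, of x] p by (simp add: algebra_simps)
  then show ?case
    using 1(2,3) 2
    by (intro exI[of _ k'] exI[of _ F'] exI[of _ r] exI[of _ A'] exI[of _ "(c, d) # P'"]) auto
qed

text \<open>The \<open>+ 4\<close> is the doubled potential 2 that the finished output
  \<open>r\<close> retains.\<close>

lemma add_position:
  assumes "straight n k F" "set A \<subseteq> F" "set P \<subseteq> F \<times> F" "A \<noteq> [] \<or> P \<noteq> []"
  shows "\<exists>k' F' r A' P'. straight n k' F' \<and> F \<subseteq> F' \<and> r \<in> F' \<and> set A' \<subseteq> F' \<and> set P' \<subseteq> F' \<times> F' \<and>
    (\<forall>x. tally A P x = of_bool (r x) + 2 * tally A' P' x) \<and>
    2 * k' + 9 * length A' + 16 * length P' + 4 \<le> 2 * k + 9 * length A + 16 * length P"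
proof -
  obtain k1 F1 B Q where 1: "straight n k1 F1" "F \<subseteq> F1" "set B \<subseteq> F1" "set Q \<subseteq> F1 \<times> F1"
    "length B \<le> 1" "B \<noteq> [] \<or> Q \<noteq> []" "tally B Q = tally A P"
    "2 * k1 + 9 * length B + 16 * length Q \<le> 2 * k + 9 * length A + 16 * length P"
    using pair_up[OF assms(1-3)] assms(4) by blast
  have "\<exists>k' F' r A' P'. straight n k' F' \<and> F1 \<subseteq> F' \<and> r \<in> F' \<and> set A' \<subseteq> F' \<and> set P' \<subseteq> F' \<times> F' \<and>
    (\<forall>x. tally B Q x = of_bool (r x) + 2 * tally A' P' x) \<and>
    2 * k' + 9 * length A' + 16 * length P' + 4 \<le> 2 * k1 + 9 * length B + 16 * length Q"
  proof (cases B)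
    \<comment> \<open>The weight 9 of \<open>z\<close> covers the retained 4 and the possible
      deficit 1 of \<open>add_pairs\<close>.\<close>
    case (Cons z B')
    then have B: "B = [z]"
      using 1(5) by simp
    then obtain k' F' r A' P' where "straight n k' F'" "F1 \<subseteq> F'" "r \<in> F'" "set A' \<subseteq> F'"
      "set P' \<subseteq> F' \<times> F'"
      "\<forall>x. of_bool (z x) + tally [] Q x = of_bool (r x) + 2 * tally A' P' x"
      "2 * k' + 9 * length A' + 16 * length P' \<le> 2 * k1 + 16 * length Q + 1"
      using add_pairs[OF 1(1) _ 1(4), of z] 1(3) by auto
    then show ?thesis
      using B by (intro exI[of _ k'] exI[of _ F'] exI[of _ r] exI[of _ A'] exI[of _ P']) auto
  next
    case Nil
    with 1(6) obtain a b Q' where Q: "Q = (a, b) # Q'"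
      by (cases Q) auto
    \<comment> \<open>A half adder on the first pair: its sum bit is \<open>b\<close> itself, so
      only the carry costs a gate. The pair's weight 16 is exactly 2 for the gate, 9 for the carry,
      1 for the deficit of \<open>add_pairs\<close> and 4 for the output.\<close>
    define c where "c = (\<lambda>x. a x \<and> \<not> b x)"
    have "straight n (Suc k1) (insert c F1)"
      unfolding c_def
      using straight.gate[OF 1(1), of a b "\<lambda>p q. p \<and> \<not> q"] 1(4) Q by simp
    moreover have "set Q' \<subseteq> insert c F1 \<times> insert c F1"
      using 1(4) Q by auto
    ultimately obtain k' F' r A' P' where 2: "straight n k' F'" "insert c F1 \<subseteq> F'" "r \<in> F'"
      "set A' \<subseteq> F'" "set P' \<subseteq> F' \<times> F'"
      "\<forall>x. of_bool (b x) + tally [] Q' x = of_bool (r x) + 2 * tally A' P' x"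
      "2 * k' + 9 * length A' + 16 * length P' \<le> 2 * Suc k1 + 16 * length Q' + 1"
      using add_pairs[of n "Suc k1" "insert c F1" b Q'] 1(4) Q by auto
    have "tally B Q x = of_bool (r x) + 2 * tally (c # A') P' x" for x
      using 2(6)[rule_format, of x] Nil Q by (auto simp: c_def)
    then show ?thesis
      using 2 Nil Q
      by (intro exI[of _ k'] exI[of _ F'] exI[of _ r] exI[of _ "c # A'"] exI[of _ P']) auto
  qed
  then show ?thesis
    using 1 by (smt (verit) order_trans)
qed

section \<open>All bit positions\<close>

text \<open>Positions at which no bit arrives get the constant \<open>False\<close> in \<open>R\<close> and retain no potential.
  After enough positions the remaining \<open>tally\<close> vanishes because the sum is bounded, so
  termination of the carries is not needed.\<close>

lemma add_positions:
  "\<exists>k F A P R. straight (length s) k F \<and> set A \<subseteq> F \<and> set P \<subseteq> F \<times> F \<and> set R \<subseteq> F \<and> length R = T \<and>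
    (\<forall>x. (\<Sum>i | i < length s \<and> s ! i < T. 2 ^ (s ! i) * of_bool (x ! i)) =
      horner_sum of_bool 2 (map (\<lambda>r. r x) R) + 2 ^ T * tally A P x) \<and>
    2 * k + 9 * length A + 16 * length P + 4 * length (filter (\<lambda>r. r \<noteq> (\<lambda>x. False)) R) \<le>
      9 * card {i. i < length s \<and> s ! i < T}"
proof (induction T)
  case 0
  show ?case
    using straight.inputs[of "length s"]
    by (intro exI[of _ 0] exI[of _ "(\<lambda>i x. x ! i) ` {..<length s} \<union> range (\<lambda>b x. b)"] exI[of _ "[]"]) auto
next
  case (Suc T)
  then obtain k F A P R where *: "straight (length s) k F" "set A \<subseteq> F" "set P \<subseteq> F \<times> F"
    "set R \<subseteq> F" "length R = T"
    "\<And>x. (\<Sum>i | i < length s \<and> s ! i < T. 2 ^ (s ! i) * of_bool (x ! i)) =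
      horner_sum of_bool 2 (map (\<lambda>r. r x) R) + 2 ^ T * tally A P x"
    "2 * k + 9 * length A + 16 * length P + 4 * length (filter (\<lambda>r. r \<noteq> (\<lambda>x. False)) R) \<le>
      9 * card {i. i < length s \<and> s ! i < T}"
    by blast
  have inputs: "(\<lambda>i x. x ! i) ` {..<length s} \<union> range (\<lambda>b x. b) \<subseteq> F"
    using *(1) by induction auto
  \<comment> \<open>The inputs of weight 2^T join the carries arriving from below; each brings the 9
    by which the right-hand bound grows.\<close>
  define I where "I = filter (\<lambda>i. s ! i = T) [0..<length s]"
  let ?A = "A @ map (\<lambda>i x. x ! i) I"
  have I: "distinct I" "set I = {i. i < length s \<and> s ! i = T}"
    by (auto simp: I_def)
  have split: "{i. i < length s \<and> s ! i < Suc T} = {i. i < length s \<and> s ! i < T} \<union> set I"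
    "{i. i < length s \<and> s ! i < T} \<inter> set I = {}"
    by (auto simp: I(2))
  have card: "card {i. i < length s \<and> s ! i < Suc T} = card {i. i < length s \<and> s ! i < T} + length I"
    unfolding split(1) using split(2) distinct_card[OF I(1)] by (simp add: card_Un_disjoint)
  have "(\<Sum>i\<in>set I. 2 ^ (s ! i) * of_bool (x ! i)) = 2 ^ T * tally (map (\<lambda>i x. x ! i) I) [] x"
    for x :: "bool list"
  proof -
    have "(\<Sum>i\<in>set I. 2 ^ (s ! i) * of_bool (x ! i)) = (\<Sum>i\<in>set I. 2 ^ T * of_bool (x ! i) :: nat)"
      by (rule sum.cong) (auto simp: I(2))
    then show ?thesis
      using I(1)
      by (simp add: tally_def sum_list_distinct_conv_sum_set sum_distrib_left comp_def del: set_map)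
  qed
  then have sum: "(\<Sum>i | i < length s \<and> s ! i < Suc T. 2 ^ (s ! i) * of_bool (x ! i)) =
      horner_sum of_bool 2 (map (\<lambda>r. r x) R) + 2 ^ T * tally ?A P x" for x
    unfolding split(1) using *(6)[of x]
    by (subst sum.union_disjoint) (simp_all add: split(2) tally_append distrib_left del: sum_mult_of_bool_eq)
  have A: "set ?A \<subseteq> F"
    using *(2) inputs I(2) by auto
  show ?case
  proof (cases "?A = [] \<and> P = []")
    case True
    then show ?thesis
      using * inputs sum card
      by (intro exI[of _ k] exI[of _ F] exI[of _ "[]"] exI[of _ "R @ [\<lambda>x. False]"])
        (auto simp: horner_sum_append)
  next
    case False
    then obtain k' F' r A' P' where **: "straight (length s) k' F'" "F \<subseteq> F'" "r \<in> F'" "set A' \<subseteq> F'"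
      "set P' \<subseteq> F' \<times> F'" "\<forall>x. tally ?A P x = of_bool (r x) + 2 * tally A' P' x"
      "2 * k' + 9 * length A' + 16 * length P' + 4 \<le> 2 * k + 9 * length ?A + 16 * length P"
      using add_position[OF *(1) A *(3)] by blast
    \<comment> \<open>If \<open>r\<close> happens to be constantly false, the filter skips it and
      the inequality only becomes looser.\<close>
    have "(\<Sum>i | i < length s \<and> s ! i < Suc T. 2 ^ (s ! i) * of_bool (x ! i)) =
      horner_sum of_bool 2 (map (\<lambda>r. r x) (R @ [r])) + 2 ^ Suc T * tally A' P' x" for x
      using sum[of x] **(6)[rule_format, of x] *(5) by (simp add: horner_sum_append algebra_simps)
    then show ?thesis
      using * ** card
      by (intro exI[of _ k'] exI[of _ F'] exI[of _ A'] exI[of _ P'] exI[of _ "R @ [r]"]) auto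
  qed
qed

theorem theorem1:
  fixes n :: nat and s :: "nat list"
  assumes "n \<ge> 1" and "length s = n"
  shows "\<exists>C. computes n C (BA s) \<and>
             real (circuit_size C) \<le> 4.5 * real n - 2 * real (BA_outputs s)"
proof -
  \<comment> \<open>This \<open>T\<close> exceeds every \<open>s ! i\<close>, so all inputs are
    absorbed, and the sum is at most T < 2^T, so nothing remains above the first \<open>T\<close>
    positions.\<close>
  define T where "T = (\<Sum>i<length s. 2 ^ (s ! i) :: nat)"
  have small: "s ! i < T" if "i < length s" for i
  proof -
    have "s ! i < 2 ^ (s ! i)"
      by (rule less_exp)
    also have "\<dots> \<le> T"
      unfolding T_def using that by (intro member_le_sum) auto
    finally show ?thesis .
  qed
  then have all: "{i. i < length s \<and> s ! i < T} = {..<length s}"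
    by auto
  obtain k F A P R where *: "straight n k F" "set R \<subseteq> F" "length R = T"
    "\<And>x. weighted_sum s x = horner_sum of_bool 2 (map (\<lambda>r. r x) R) + 2 ^ T * tally A P x"
    "2 * k + 4 * length (filter (\<lambda>r. r \<noteq> (\<lambda>x. False)) R) \<le> 9 * n"
    using add_positions[of s T] assms(2) unfolding all weighted_sum_def by auto
  \<comment> \<open>This covers lists of any length, since \<open>x ! i\<close> always has some
    value; the later equality with \<open>BA s\<close> as functions relies on that.\<close>
  have bits: "bit (weighted_sum s x) t \<longleftrightarrow> t < T \<and> (R ! t) x" for x t
  proof -
    have "weighted_sum s x \<le> T"
      unfolding weighted_sum_def T_def by (rule sum_mono) auto
    also have "T < 2 ^ T"
      by (rule less_exp)
    finally have "tally A P x = 0"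
      using *(4)[of x] by (cases "tally A P x") auto
    then show ?thesis
      using *(3,4) by (auto simp: bit_horner_sum_bit_iff)
  qed
  \<comment> \<open>Every output of \<open>BA\<close> therefore retains weight 4, which gives the
    doubled form of the claimed bound.\<close>
  have "BA_positions s \<subseteq> {t. t < length R \<and> R ! t \<noteq> (\<lambda>x. False)}"
    by (auto simp: BA_positions_def bits *(3))
  then have "BA_outputs s \<le> length (filter (\<lambda>r. r \<noteq> (\<lambda>x. False)) R)"
    unfolding BA_outputs_def length_filter_conv_card by (intro card_mono) auto
  then have size: "2 * k + 4 * BA_outputs s \<le> 9 * n"
    using *(5) by linarith
  let ?fs = "map ((!) R) (sorted_list_of_set (BA_positions s))"
  have pos: "t < T" if "t \<in> BA_positions s" for t
    using that by (auto simp: BA_positions_def bits)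
  then have "set ?fs \<subseteq> F"
    using *(2,3) finite_BA_positions[of s] by (auto intro: subsetD[OF _ nth_mem])
  from straight_computes[OF *(1) this]
  obtain C where "computes n C (\<lambda>x. map (\<lambda>f. f x) ?fs)" "circuit_size C = k"
    by blast
  moreover have "(\<lambda>x. map (\<lambda>f. f x) ?fs) = BA s"
    using pos finite_BA_positions[of s] by (auto simp: BA_def bits)
  ultimately show ?thesis
    using size by (intro exI[of _ C]) (simp add: field_simps)
qed

end
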